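(* Let $(M,g,Q,P)$ be a super-null Riemannian manifold. Then $Q$ cannot be a Killing vector field, i.e. $\mathcal{L}_Q g\neq 0$.
   Context: Supermanifolds are real, finite-dimensional, in the Berezin–Leites (locally ringed space) sense, $M=(|M|,\mathcal{O}_M)$; $C^\infty(M)$ is the superalgebra of global functions, $\mathrm{Vect}(M)$ the $C^\infty(M)$-module of vector fields, $\widetilde{\cdot}$ denotes $\mathbb{Z}_2$-parity, and $[X,Y]=XY-(-1)^{\widetilde X\widetilde Y}YX$ is the graded commutator. A metric $g$ on $M$ is an even, graded-symmetric, rank 2 covariant tensor, possibly degenerate; it determines a pairing $\langle X|Y\rangle$ with $\widetilde{\langle X|Y\rangle}=\widetilde X+\widetilde Y$, $\langle X|Y\rangle=(-1)^{\widetilde X\widetilde Y}\langle Y|X\rangle$, $\langle fX+Y|Z\rangle=f\langle X|Z\rangle+\langle Y|Z\rangle$. Its kernel is $\ker(g)=\{X\in\mathrm{Vect}(M) : \langle X|Y\rangle=0\ \text{for all } Y\in\mathrm{Vect}(M)\}$; $g$ is degenerate if $\ker(g)\neq\{0\}$. The Lie derivative of $g$ is $(\mathcal{L}_Xg)(Y,Z)=X\langle Y|Z\rangle-\langle[X,Y]|Z\rangle-(-1)^{\widetilde X\widetilde Y}\langle Y|[X,Z]\rangle$, and $X$ is Killing if $\mathcal{L}_Xg=0$. A super-null Riemannian manifold is a quadruple $(M,g,Q,P)$ where $M$ is a supermanifold of dimension $n|1$ ($n\ge 1$), $g$ is a degenerate (even) metric on $M$, $Q\in\mathrm{Vect}(M)$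 is a non-singular odd vector field (i.e. its value in $T_mM$ is nonzero at every point $m\in|M|$) with $[Q,Q]=2P$ for an even vector field $P$, and $\ker(g)=\mathrm{Span}\{Q\}$ (the $C^\infty(M)$-span). It is part of the setting that the rank of the kernel is constant, equal to $0|1$ (at every point $m\in |M|$ the bilinear form induced by $g$ on $T_mM$ has kernel of dimension $0|1$), and that around every point of $|M|$ there are Shander coordinates $(x^a,t,\tau)$, with $x^a,t$ even and $\tau$ odd, in which $Q=\partial_\tau+\tau\partial_t$ and $P=\partial_t$. *)

theory Defs
  imports "HOL-Analysis.Analysis" "HOL-Library.Z2" "HOL-Algebra.Module"
begin

section \<open>Real superalgebras\<close>

text \<open>Parities are elements of the two-element field \<^typ>\<open>bit\<close>.\<close>

definition psign :: "bit \<Rightarrow> real"  \<comment> \<open>\<open>(-1)\<^sup>p\<close>\<close>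
  where "psign p = (if p = 0 then 1 else - 1)"

definition real_ring :: "real ring" where
  "real_ring = \<lparr>carrier = UNIV, mult = (*), one = 1, zero = 0, add = (+)\<rparr>"

record 's salg = "(real, 's) module" +
  homog :: "bit \<Rightarrow> 's set"

text \<open>The locale \<^locale>\<open>algebra\<close> requires commutativity, hence ring and module structure are
  combined here by hand.  The zero algebra is allowed (sections over the empty set).\<close>

definition superalgebra :: "'s salg \<Rightarrow> bool" where
  "superalgebra A \<longleftrightarrow>
     ring A \<and> Module.module real_ring A \<and>
     (\<forall>c. \<forall>x\<in>carrier A. \<forall>y\<in>carrier A.
        (c \<odot>\<^bsub>A\<^esub> x) \<otimes>\<^bsub>A\<^esub> y = c \<odot>\<^bsub>A\<^esub> (x \<otimes>\<^bsub>A\<^esub> y) \<and>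
        x \<otimes>\<^bsub>A\<^esub> (c \<odot>\<^bsub>A\<^esub> y) = c \<odot>\<^bsub>A\<^esub> (x \<otimes>\<^bsub>A\<^esub> y)) \<and>
     (\<forall>p. homog A p \<subseteq> carrier A \<and> \<zero>\<^bsub>A\<^esub> \<in> homog A p \<and>
        (\<forall>x\<in>homog A p. \<forall>y\<in>homog A p. x \<oplus>\<^bsub>A\<^esub> y \<in> homog A p) \<and>
        (\<forall>c. \<forall>x\<in>homog A p. c \<odot>\<^bsub>A\<^esub> x \<in> homog A p)) \<and>
     (\<forall>x\<in>carrier A. \<exists>!(a, b). a \<in> homog A 0 \<and> b \<in> homog A 1 \<and> x = a \<oplus>\<^bsub>A\<^esub> b) \<and>
     \<one>\<^bsub>A\<^esub> \<in> homog A 0 \<and>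
     (\<forall>p q. \<forall>x\<in>homog A p. \<forall>y\<in>homog A q.
        x \<otimes>\<^bsub>A\<^esub> y \<in> homog A (p + q) \<and> x \<otimes>\<^bsub>A\<^esub> y = psign (p * q) \<odot>\<^bsub>A\<^esub> (y \<otimes>\<^bsub>A\<^esub> x))"

definition salg_hom :: "'s salg \<Rightarrow> 't salg \<Rightarrow> ('s \<Rightarrow> 't) set" where
  "salg_hom A B = {h \<in> ring_hom A B.
     (\<forall>c. \<forall>x\<in>carrier A. h (c \<odot>\<^bsub>A\<^esub> x) = c \<odot>\<^bsub>B\<^esub> h x) \<and> (\<forall>p. h ` homog A p \<subseteq> homog B p)}"

definition salg_iso :: "'s salg \<Rightarrow> 't salg \<Rightarrow> ('s \<Rightarrow> 't) set" where
  "salg_iso A B = {h \<in> salg_hom A B. bij_betw h (carrier A) (carrier B)}"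


section \<open>Superspaces\<close>

text \<open>\<open>body M\<close> is the underlying space \<open>|M|\<close>, \<open>sect M U\<close> is \<open>\<O>\<^sub>M(U)\<close>, and \<open>restr M U V\<close> is the
  restriction \<open>\<O>\<^sub>M(U) \<rightarrow> \<O>\<^sub>M(V)\<close>.  Only values at open sets matter.\<close>

record ('p, 's) superspace =
  body :: "'p topology"
  sect :: "'p set \<Rightarrow> 's salg"
  restr :: "'p set \<Rightarrow> 'p set \<Rightarrow> 's \<Rightarrow> 's"

abbreviation points :: "('p, 's) superspace \<Rightarrow> 'p set"
  where "points M \<equiv> topspace (body M)"

abbreviation opens :: "('p, 's) superspace \<Rightarrow> 'p set set"
  where "opens M \<equiv> {U. openin (body M) U}"

abbreviation nbhds :: "('p, 's) superspace \<Rightarrow> 'p \<Rightarrow> 'p set set"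
  where "nbhds M m \<equiv> {U. openin (body M) U \<and> m \<in> U}"

abbreviation smooth_functions :: "('p, 's) superspace \<Rightarrow> 's salg"  \<comment> \<open>\<open>C\<^sup>\<infinity>(M)\<close>\<close>
  where "smooth_functions M \<equiv> sect M (points M)"

definition sheaf :: "('p, 's) superspace \<Rightarrow> bool" where
  "sheaf M \<longleftrightarrow>
     (\<forall>U\<in>opens M. superalgebra (sect M U)) \<and>
     (\<forall>U\<in>opens M. \<forall>V\<in>opens M. V \<subseteq> U \<longrightarrow> restr M U V \<in> salg_hom (sect M U) (sect M V)) \<and>
     (\<forall>U\<in>opens M. \<forall>s\<in>carrier (sect M U). restr M U U s = s) \<and>
     (\<forall>U\<in>opens M. \<forall>V\<in>opens M. \<forall>W\<in>opens M. W \<subseteq> V \<and> V \<subseteq> U \<longrightarrow>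
        (\<forall>s\<in>carrier (sect M U). restr M V W (restr M U V s) = restr M U W s)) \<and>
     (\<forall>\<U> s. \<U> \<subseteq> opens M \<and> (\<forall>U\<in>\<U>. s U \<in> carrier (sect M U)) \<and>
        (\<forall>U\<in>\<U>. \<forall>V\<in>\<U>. restr M U (U \<inter> V) (s U) = restr M V (U \<inter> V) (s V)) \<longrightarrow>
        (\<exists>!t. t \<in> carrier (sect M (\<Union>\<U>)) \<and> (\<forall>U\<in>\<U>. restr M (\<Union>\<U>) U t = s U)))"

text \<open>\<open>germ_unit M m U s\<close>: the germ at \<open>m\<close> of the section \<open>s\<close> over \<open>U\<close> is invertible in the stalk.\<close>

definition germ_unit :: "('p, 's) superspace \<Rightarrow> 'p \<Rightarrow> 'p set \<Rightarrow> 's \<Rightarrow> bool" where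
  "germ_unit M m U s \<longleftrightarrow> (\<exists>W\<in>nbhds M m. W \<subseteq> U \<and> restr M U W s \<in> Units (sect M W))"

text \<open>The stalk at \<open>m\<close> is a local ring: it is nonzero, and the sum of two non-units is a non-unit.\<close>

definition local_stalk :: "('p, 's) superspace \<Rightarrow> 'p \<Rightarrow> bool" where
  "local_stalk M m \<longleftrightarrow>
     (\<forall>U\<in>nbhds M m. \<one>\<^bsub>sect M U\<^esub> \<noteq> \<zero>\<^bsub>sect M U\<^esub>) \<and>
     (\<forall>U\<in>nbhds M m. \<forall>s\<in>carrier (sect M U). \<forall>t\<in>carrier (sect M U).
        germ_unit M m U (s \<oplus>\<^bsub>sect M U\<^esub> t) \<longrightarrow> germ_unit M m U s \<or> germ_unit M m U t)"

definition locally_superringed_space :: "('p, 's) superspace \<Rightarrow> bool" where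
  "locally_superringed_space M \<longleftrightarrow> sheaf M \<and> (\<forall>m\<in>points M. local_stalk M m)"

text \<open>The value \<open>s(m)\<close>: the unique real number \<open>c\<close> such that \<open>s - c\<close> is not invertible near \<open>m\<close>.\<close>

definition value_at :: "('p, 's) superspace \<Rightarrow> 'p set \<Rightarrow> 's \<Rightarrow> 'p \<Rightarrow> real" where
  "value_at M U s m = (THE c. \<not> germ_unit M m U (s \<ominus>\<^bsub>sect M U\<^esub> (c \<odot>\<^bsub>sect M U\<^esub> \<one>\<^bsub>sect M U\<^esub>)))"


section \<open>Vector fields\<close>

text \<open>A vector field is a global section of the sheaf of graded derivations: a family of derivations
  of the \<open>\<O>\<^sub>M(U)\<close> compatible with restrictions.  Families are taken extensional, so that equality of
  vector fields is equality in HOL.\<close>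

type_synonym ('p, 's) vfield = "'p set \<Rightarrow> 's \<Rightarrow> 's"

definition vf_homog :: "('p, 's) superspace \<Rightarrow> bit \<Rightarrow> ('p, 's) vfield set" where
  "vf_homog M p = {X \<in> (\<Pi>\<^sub>E U\<in>opens M. carrier (sect M U) \<rightarrow>\<^sub>E carrier (sect M U)).
     (\<forall>U\<in>opens M.
        (\<forall>s\<in>carrier (sect M U). \<forall>t\<in>carrier (sect M U).
            X U (s \<oplus>\<^bsub>sect M U\<^esub> t) = X U s \<oplus>\<^bsub>sect M U\<^esub> X U t) \<and>
        (\<forall>c. \<forall>s\<in>carrier (sect M U). X U (c \<odot>\<^bsub>sect M U\<^esub> s) = c \<odot>\<^bsub>sect M U\<^esub> X U s) \<and>
        (\<forall>q. \<forall>s\<in>homog (sect M U) q. X U s \<in> homog (sect M U) (p + q)) \<and>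
        (\<forall>q. \<forall>s\<in>homog (sect M U) q. \<forall>t\<in>carrier (sect M U).
            X U (s \<otimes>\<^bsub>sect M U\<^esub> t) =
              X U s \<otimes>\<^bsub>sect M U\<^esub> t
              \<oplus>\<^bsub>sect M U\<^esub> psign (p * q) \<odot>\<^bsub>sect M U\<^esub> (s \<otimes>\<^bsub>sect M U\<^esub> X U t))) \<and>
     (\<forall>U\<in>opens M. \<forall>V\<in>opens M. V \<subseteq> U \<longrightarrow>
        (\<forall>s\<in>carrier (sect M U). X V (restr M U V s) = restr M U V (X U s)))}"

definition vf_zero :: "('p, 's) superspace \<Rightarrow> ('p, 's) vfield" where
  "vf_zero M = (\<lambda>U\<in>opens M. \<lambda>s\<in>carrier (sect M U). \<zero>\<^bsub>sect M U\<^esub>)"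

definition vf_add :: "('p, 's) superspace \<Rightarrow> ('p, 's) vfield \<Rightarrow> ('p, 's) vfield \<Rightarrow> ('p, 's) vfield" where
  "vf_add M X Y = (\<lambda>U\<in>opens M. \<lambda>s\<in>carrier (sect M U). X U s \<oplus>\<^bsub>sect M U\<^esub> Y U s)"

definition vf_scale :: "('p, 's) superspace \<Rightarrow> 's \<Rightarrow> ('p, 's) vfield \<Rightarrow> ('p, 's) vfield" where
  "vf_scale M f X =
     (\<lambda>U\<in>opens M. \<lambda>s\<in>carrier (sect M U). restr M (points M) U f \<otimes>\<^bsub>sect M U\<^esub> X U s)"

definition Vect :: "('p, 's) superspace \<Rightarrow> ('p, 's) vfield set" where
  "Vect M = {vf_add M X Y | X Y. X \<in> vf_homog M 0 \<and> Y \<in> vf_homog M 1}"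

text \<open>Parity of a homogeneous vector field.  The zero field belongs to both \<^term>\<open>vf_homog M 0\<close> and
  \<^term>\<open>vf_homog M 1\<close>; its parity only enters as the sign of a vanishing term.\<close>

definition parity :: "('p, 's) superspace \<Rightarrow> ('p, 's) vfield \<Rightarrow> bit" where
  "parity M X = (if X \<in> vf_homog M 1 then 1 else 0)"

text \<open>Graded commutator of homogeneous vector fields.\<close>

definition bracket :: "('p, 's) superspace \<Rightarrow> ('p, 's) vfield \<Rightarrow> ('p, 's) vfield \<Rightarrow> ('p, 's) vfield" where
  "bracket M X Y = (\<lambda>U\<in>opens M. \<lambda>s\<in>carrier (sect M U).
     X U (Y U s) \<ominus>\<^bsub>sect M U\<^esub> (psign (parity M X * parity M Y) \<odot>\<^bsub>sect M U\<^esub> Y U (X U s)))"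

definition vf_span :: "('p, 's) superspace \<Rightarrow> ('p, 's) vfield \<Rightarrow> ('p, 's) vfield set" where
  "vf_span M X = {vf_scale M f X | f. f \<in> carrier (smooth_functions M)}"


section \<open>Tangent spaces\<close>

text \<open>Elements of \<open>T\<^sub>mM\<close> are derivations from the stalk at \<open>m\<close> to \<open>\<real>\<close>, given as compatible families of
  functionals on the \<open>\<O>\<^sub>M(U)\<close> with \<open>m \<in> U\<close>.  A derivation of parity \<open>p\<close> vanishes on germs of parity
  different from \<open>p\<close>, because \<open>\<real>\<close> is purely even.\<close>

type_synonym ('p, 's) tangent = "'p set \<Rightarrow> 's \<Rightarrow> real"

definition tan_homog :: "('p, 's) superspace \<Rightarrow> 'p \<Rightarrow> bit \<Rightarrow> ('p, 's) tangent set" where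
  "tan_homog M m p = {v \<in> (\<Pi>\<^sub>E U\<in>nbhds M m. carrier (sect M U) \<rightarrow>\<^sub>E UNIV).
     (\<forall>U\<in>nbhds M m.
        (\<forall>s\<in>carrier (sect M U). \<forall>t\<in>carrier (sect M U). v U (s \<oplus>\<^bsub>sect M U\<^esub> t) = v U s + v U t) \<and>
        (\<forall>c. \<forall>s\<in>carrier (sect M U). v U (c \<odot>\<^bsub>sect M U\<^esub> s) = c * v U s) \<and>
        (\<forall>q. q \<noteq> p \<longrightarrow> (\<forall>s\<in>homog (sect M U) q. v U s = 0)) \<and>
        (\<forall>q. \<forall>s\<in>homog (sect M U) q. \<forall>t\<in>carrier (sect M U).
            v U (s \<otimes>\<^bsub>sect M U\<^esub> t) =
              v U s * value_at M U t m + psign (p * q) * value_at M U s m * v U t)) \<and>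
     (\<forall>U\<in>nbhds M m. \<forall>V\<in>nbhds M m. V \<subseteq> U \<longrightarrow>
        (\<forall>s\<in>carrier (sect M U). v V (restr M U V s) = v U s))}"

definition tan_comb ::
  "('p, 's) superspace \<Rightarrow> 'p \<Rightarrow> nat \<Rightarrow> (nat \<Rightarrow> ('p, 's) tangent) \<Rightarrow> (nat \<Rightarrow> real) \<Rightarrow> ('p, 's) tangent" where
  "tan_comb M m d b c = (\<lambda>U\<in>nbhds M m. \<lambda>s\<in>carrier (sect M U). \<Sum>i<d. c i * b i U s)"

definition tan_zero :: "('p, 's) superspace \<Rightarrow> 'p \<Rightarrow> ('p, 's) tangent" where
  "tan_zero M m = (\<lambda>U\<in>nbhds M m. \<lambda>s\<in>carrier (sect M U). 0)"

definition tan_add ::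
  "('p, 's) superspace \<Rightarrow> 'p \<Rightarrow> ('p, 's) tangent \<Rightarrow> ('p, 's) tangent \<Rightarrow> ('p, 's) tangent" where
  "tan_add M m v w = (\<lambda>U\<in>nbhds M m. \<lambda>s\<in>carrier (sect M U). v U s + w U s)"

definition tangent_space :: "('p, 's) superspace \<Rightarrow> 'p \<Rightarrow> ('p, 's) tangent set" where
  "tangent_space M m = {tan_add M m v w | v w. v \<in> tan_homog M m 0 \<and> w \<in> tan_homog M m 1}"

definition vf_at :: "('p, 's) superspace \<Rightarrow> ('p, 's) vfield \<Rightarrow> 'p \<Rightarrow> ('p, 's) tangent" where
  "vf_at M X m = (\<lambda>U\<in>nbhds M m. \<lambda>s\<in>carrier (sect M U). value_at M U (X U s) m)"

definition nonsingular :: "('p, 's) superspace \<Rightarrow> ('p, 's) vfield \<Rightarrow> bool" where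
  "nonsingular M X \<longleftrightarrow> (\<forall>m\<in>points M. vf_at M X m \<noteq> tan_zero M m)"

text \<open>\<open>S\<close> is a real vector space with a basis of \<open>d\<close> elements: the coordinate map
  \<open>\<real>\<^sup>d \<rightarrow> S\<close> of some family \<open>b\<close> is bijective.\<close>

definition tan_has_dim ::
  "('p, 's) superspace \<Rightarrow> 'p \<Rightarrow> ('p, 's) tangent set \<Rightarrow> nat \<Rightarrow> bool" where
  "tan_has_dim M m S d \<longleftrightarrow> (\<exists>b. bij_betw (tan_comb M m d b) ({..<d} \<rightarrow>\<^sub>E UNIV) S)"

definition tan_has_sdim ::
  "('p, 's) superspace \<Rightarrow> 'p \<Rightarrow> ('p, 's) tangent set \<Rightarrow> nat \<Rightarrow> nat \<Rightarrow> bool" where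
  "tan_has_sdim M m S d e \<longleftrightarrow>
     S = {tan_add M m v w | v w. v \<in> S \<inter> tan_homog M m 0 \<and> w \<in> S \<inter> tan_homog M m 1} \<and>
     tan_has_dim M m (S \<inter> tan_homog M m 0) d \<and> tan_has_dim M m (S \<inter> tan_homog M m 1) e"


section \<open>Metrics\<close>

type_synonym ('p, 's) pairing = "('p, 's) vfield \<Rightarrow> ('p, 's) vfield \<Rightarrow> 's"

text \<open>An even metric as its pairing \<open>\<langle>X|Y\<rangle>\<close> on \<open>Vect(M)\<close>.  Additivity in the second argument
  follows from symmetry only for homogeneous arguments and is therefore stated as well.\<close>

definition metric :: "('p, 's) superspace \<Rightarrow> ('p, 's) pairing \<Rightarrow> bool" where
  "metric M g \<longleftrightarrow>
     (\<forall>X\<in>Vect M. \<forall>Y\<in>Vect M. g X Y \<in> carrier (smooth_functions M)) \<and>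
     (\<forall>p q. \<forall>X\<in>vf_homog M p. \<forall>Y\<in>vf_homog M q.
        g X Y \<in> homog (smooth_functions M) (p + q) \<and>
        g X Y = psign (p * q) \<odot>\<^bsub>smooth_functions M\<^esub> g Y X) \<and>
     (\<forall>f\<in>carrier (smooth_functions M). \<forall>X\<in>Vect M. \<forall>Y\<in>Vect M. \<forall>Z\<in>Vect M.
        g (vf_add M (vf_scale M f X) Y) Z =
          f \<otimes>\<^bsub>smooth_functions M\<^esub> g X Z \<oplus>\<^bsub>smooth_functions M\<^esub> g Y Z) \<and>
     (\<forall>X\<in>Vect M. \<forall>Y\<in>Vect M. \<forall>Z\<in>Vect M.
        g X (vf_add M Y Z) = g X Y \<oplus>\<^bsub>smooth_functions M\<^esub> g X Z)"

definition metric_ker :: "('p, 's) superspace \<Rightarrow> ('p, 's) pairing \<Rightarrow> ('p, 's) vfield set" where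
  "metric_ker M g = {X \<in> Vect M. \<forall>Y\<in>Vect M. g X Y = \<zero>\<^bsub>smooth_functions M\<^esub>}"

definition degenerate :: "('p, 's) superspace \<Rightarrow> ('p, 's) pairing \<Rightarrow> bool" where
  "degenerate M g \<longleftrightarrow> metric_ker M g \<noteq> {vf_zero M}"

text \<open>The bilinear form induced on \<open>T\<^sub>mM\<close>, \<open>(X\<^sub>m, Y\<^sub>m) \<mapsto> \<langle>X|Y\<rangle>(m)\<close>.  On a supermanifold every tangent
  vector is the value of a global vector field, and the result does not depend on its choice.\<close>

definition metric_at ::
  "('p, 's) superspace \<Rightarrow> ('p, 's) pairing \<Rightarrow> 'p \<Rightarrow> ('p, 's) tangent \<Rightarrow> ('p, 's) tangent \<Rightarrow> real" where
  "metric_at M g m v w =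
     (THE c. \<exists>X\<in>Vect M. \<exists>Y\<in>Vect M.
        vf_at M X m = v \<and> vf_at M Y m = w \<and> c = value_at M (points M) (g X Y) m)"

definition metric_ker_at ::
  "('p, 's) superspace \<Rightarrow> ('p, 's) pairing \<Rightarrow> 'p \<Rightarrow> ('p, 's) tangent set" where
  "metric_ker_at M g m = {v \<in> tangent_space M m. \<forall>w\<in>tangent_space M m. metric_at M g m v w = 0}"

text \<open>The Lie derivative \<open>(\<L>\<^sub>X g)(Y, Z)\<close>, for homogeneous arguments; being biadditive in
  \<open>Y\<close> and \<open>Z\<close>, \<open>\<L>\<^sub>X g\<close> vanishes iff it vanishes on homogeneous fields.\<close>

definition lie_derivative ::
  "('p, 's) superspace \<Rightarrow> ('p, 's) pairing \<Rightarrow> ('p, 's) vfield \<Rightarrow> ('p, 's) pairing" where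
  "lie_derivative M g X Y Z =
     X (points M) (g Y Z)
     \<ominus>\<^bsub>smooth_functions M\<^esub> g (bracket M X Y) Z
     \<ominus>\<^bsub>smooth_functions M\<^esub>
       (psign (parity M X * parity M Y) \<odot>\<^bsub>smooth_functions M\<^esub> g Y (bracket M X Z))"

definition killing :: "('p, 's) superspace \<Rightarrow> ('p, 's) pairing \<Rightarrow> ('p, 's) vfield \<Rightarrow> bool" where
  "killing M g X \<longleftrightarrow>
     (\<forall>p q. \<forall>Y\<in>vf_homog M p. \<forall>Z\<in>vf_homog M q.
        lie_derivative M g X Y Z = \<zero>\<^bsub>smooth_functions M\<^esub>)"


section \<open>Supermanifolds\<close>

primrec C_on :: "nat \<Rightarrow> (real ^ 'n) set \<Rightarrow> (real ^ 'n \<Rightarrow> real) \<Rightarrow> bool"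
  \<comment> \<open>\<open>k\<close> times continuously differentiable on an open set\<close>
  where
    "C_on 0 U f \<longleftrightarrow> continuous_on U f"
  | "C_on (Suc k) U f \<longleftrightarrow>
       f differentiable_on U \<and> (\<forall>i. C_on k U (\<lambda>x. frechet_derivative f (at x) (axis i 1)))"

definition smooth_on :: "(real ^ 'n) set \<Rightarrow> (real ^ 'n \<Rightarrow> real) \<Rightarrow> bool"
  where "smooth_on U f \<longleftrightarrow> (\<forall>k. C_on k U f)"

text \<open>The model \<open>\<real>\<^sup>n\<^sup>|\<^sup>q\<close> with \<open>\<O>(U) = C\<^sup>\<infinity>(U) \<otimes> \<Lambda>[\<theta>\<^sub>0, \<dots>, \<theta>\<^bsub>q-1\<^esub>]\<close>.  A section is a function \<open>f\<close> with
  \<open>f x I\<close> the coefficient at \<open>x\<close> of the monomial \<open>\<theta>\<^sub>I\<close>, the product of the \<open>\<theta>\<^sub>i\<close>, \<open>i \<in> I\<close>, in increasing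
  order; it is extended by zero outside \<open>U\<close>.  Then \<open>\<theta>\<^sub>I \<theta>\<^sub>J = grass_sign I J \<theta>\<^bsub>I \<union> J\<^esub>\<close> for disjoint \<open>I\<close>, \<open>J\<close>.\<close>

definition grass_sign :: "nat set \<Rightarrow> nat set \<Rightarrow> real" where
  "grass_sign I J = (- 1) ^ card {(i, j). i \<in> I \<and> j \<in> J \<and> j < i}"

type_synonym 'n model_section = "real ^ 'n \<Rightarrow> nat set \<Rightarrow> real"

definition model_salg :: "nat \<Rightarrow> (real ^ 'n) set \<Rightarrow> 'n model_section salg" where
  "model_salg q U =
     \<lparr>carrier = {f. (\<forall>I. smooth_on U (\<lambda>x. f x I)) \<and> (\<forall>x I. x \<notin> U \<or> \<not> I \<subseteq> {..<q} \<longrightarrow> f x I = 0)},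
      mult = (\<lambda>f g x K. \<Sum>I\<in>Pow K. grass_sign I (K - I) * f x I * g x (K - I)),
      one = (\<lambda>x I. if x \<in> U \<and> I = {} then 1 else 0),
      zero = (\<lambda>x I. 0),
      add = (\<lambda>f g x I. f x I + g x I),
      smult = (\<lambda>c f x I. c * f x I),
      homog = (\<lambda>p. {f. (\<forall>I. smooth_on U (\<lambda>x. f x I)) \<and>
                 (\<forall>x I. x \<notin> U \<or> \<not> I \<subseteq> {..<q} \<or> of_nat (card I) \<noteq> p \<longrightarrow> f x I = 0)})\<rparr>"

definition model :: "nat \<Rightarrow> (real ^ 'n, 'n model_section) superspace" where
  "model q =
     \<lparr>body = euclidean,
      sect = model_salg q,
      restr = (\<lambda>U V f x I. if x \<in> V then f x I else 0)\<rparr>"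

definition partial_even :: "nat \<Rightarrow> 'n \<Rightarrow> (real ^ 'n, 'n model_section) vfield"
  where "partial_even q k = (\<lambda>U\<in>opens (model q). \<lambda>f\<in>carrier (sect (model q) U). \<lambda>x I.
     if x \<in> U then frechet_derivative (\<lambda>y. f y I) (at x) (axis k 1) else 0)"

text \<open>The sign comes from moving \<open>\<theta>\<^sub>j\<close> to the front of the monomial \<open>\<theta>\<^bsub>I \<union> {j}\<^esub>\<close>.\<close>

definition partial_odd :: "nat \<Rightarrow> nat \<Rightarrow> (real ^ 'n, 'n model_section) vfield"
  where "partial_odd q j = (\<lambda>U\<in>opens (model q). \<lambda>f\<in>carrier (sect (model q) U). \<lambda>x I.
     if j \<notin> I then (- 1) ^ card {i \<in> I. i < j} * f x (insert j I) else 0)"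

definition theta :: "nat \<Rightarrow> 'n model_section"
  where "theta j = (\<lambda>x I. if I = {j} then 1 else 0)"

text \<open>A chart of dimension \<open>n|q\<close> with \<open>n = CARD('n)\<close>: an isomorphism between the open subspaces of \<open>M\<close>
  over \<open>U\<close> and of \<open>\<real>\<^sup>n\<^sup>|\<^sup>q\<close> over \<open>V\<close>, consisting of a homeomorphism \<open>\<phi>\<close> and the pullback \<open>\<Phi>\<close> of sections.\<close>

definition chart ::
  "('p, 's) superspace \<Rightarrow> nat \<Rightarrow> 'p set \<Rightarrow> (real ^ 'n) set \<Rightarrow> ('p \<Rightarrow> real ^ 'n) \<Rightarrow>
     ((real ^ 'n) set \<Rightarrow> 'n model_section \<Rightarrow> 's) \<Rightarrow> bool" where
  "chart M q U V \<phi> \<Phi> \<longleftrightarrow>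
     openin (body M) U \<and> open V \<and>
     homeomorphic_map (subtopology (body M) U) (top_of_set V) \<phi> \<and>
     (\<forall>W. open W \<and> W \<subseteq> V \<longrightarrow> \<Phi> W \<in> salg_iso (sect (model q) W) (sect M (U \<inter> \<phi> -` W))) \<and>
     (\<forall>W W'. open W \<and> open W' \<and> W' \<subseteq> W \<and> W \<subseteq> V \<longrightarrow>
        (\<forall>f\<in>carrier (sect (model q) W).
           \<Phi> W' (restr (model q) W W' f) = restr M (U \<inter> \<phi> -` W) (U \<inter> \<phi> -` W') (\<Phi> W f)))"

definition supermanifold :: "'n::finite itself \<Rightarrow> nat \<Rightarrow> ('p, 's) superspace \<Rightarrow> bool" where
  "supermanifold _ q M \<longleftrightarrow>
     locally_superringed_space M \<and> Hausdorff_space (body M) \<and> second_countable (body M) \<and>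
     (\<forall>m\<in>points M. \<exists>U V (\<phi> :: 'p \<Rightarrow> real ^ 'n) \<Phi>. m \<in> U \<and> chart M q U V \<phi> \<Phi>)"

text \<open>The vector field \<open>X\<close> on \<open>M\<close> has the coordinate expression \<open>X'\<close> in the given chart.\<close>

definition chart_expr ::
  "('p, 's) superspace \<Rightarrow> nat \<Rightarrow> 'p set \<Rightarrow> (real ^ 'n) set \<Rightarrow> ('p \<Rightarrow> real ^ 'n) \<Rightarrow>
     ((real ^ 'n) set \<Rightarrow> 'n model_section \<Rightarrow> 's) \<Rightarrow>
     ('p, 's) vfield \<Rightarrow> (real ^ 'n, 'n model_section) vfield \<Rightarrow> bool" where
  "chart_expr M q U V \<phi> \<Phi> X X' \<longleftrightarrow>
     (\<forall>W. open W \<and> W \<subseteq> V \<longrightarrow>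
        (\<forall>f\<in>carrier (sect (model q) W). X (U \<inter> \<phi> -` W) (\<Phi> W f) = \<Phi> W (X' W f)))"


section \<open>Super-null Riemannian manifolds\<close>

text \<open>Shander coordinates \<open>(x\<^sup>a, t, \<tau>)\<close>: the index \<open>k\<close> singles out \<open>t\<close> among the even coordinates, and
  \<open>\<tau>\<close> is \<^term>\<open>theta 0\<close>.\<close>

definition shander_coordinates ::
  "('p, 's) superspace \<Rightarrow> ('p, 's) vfield \<Rightarrow> ('p, 's) vfield \<Rightarrow> 'p set \<Rightarrow> (real ^ 'n) set \<Rightarrow>
     ('p \<Rightarrow> real ^ 'n) \<Rightarrow> ((real ^ 'n) set \<Rightarrow> 'n model_section \<Rightarrow> 's) \<Rightarrow> 'n \<Rightarrow> bool" where
  "shander_coordinates M Q P U V \<phi> \<Phi> k \<longleftrightarrow>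
     chart M 1 U V \<phi> \<Phi> \<and>
     chart_expr M 1 U V \<phi> \<Phi> Q
       (vf_add (model 1) (partial_odd 1 0) (vf_scale (model 1) (theta 0) (partial_even 1 k))) \<and>
     chart_expr M 1 U V \<phi> \<Phi> P (partial_even 1 k)"

definition super_null_riemannian ::
  "'n::finite itself \<Rightarrow> ('p, 's) superspace \<Rightarrow> ('p, 's) pairing \<Rightarrow>
     ('p, 's) vfield \<Rightarrow> ('p, 's) vfield \<Rightarrow> bool" where
  "super_null_riemannian n M g Q P \<longleftrightarrow>
     supermanifold n 1 M \<and>
     metric M g \<and> degenerate M g \<and>
     Q \<in> vf_homog M 1 \<and> nonsingular M Q \<and>
     P \<in> vf_homog M 0 \<and> bracket M Q Q = vf_add M P P \<and>
     metric_ker M g = vf_span M Q \<and>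
     (\<forall>m\<in>points M. tan_has_sdim M m (metric_ker_at M g m) 0 1) \<and>
     (\<forall>m\<in>points M. \<exists>U V (\<phi> :: 'p \<Rightarrow> real ^ 'n) \<Phi> k.
        m \<in> U \<and> shander_coordinates M Q P U V \<phi> \<Phi> k)"

end

(* If Q is Killing, evaluating (L_Q g)(Y, Q) kills every term except <Y|[Q,Q]> = 2<Y|P>, because Q lies in
   ker g; hence P lies in ker g = Span{Q}, say P = f Q.  In Shander coordinates P annihilates tau while
   Q tau = 1, so f = 0 there and P = 0, contradicting P t = 1. *)

theory Submission
  imports Defs "HOL-Algebra.RingHom"
begin

section \<open>Scalars, signs and parity in a real superalgebra\<close>

section \<open>Superalgebras\<close>

lemma superalgebra_ring: "superalgebra A \<Longrightarrow> ring A"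
  and superalgebra_module: "superalgebra A \<Longrightarrow> Module.module real_ring A"
  by (auto simp: superalgebra_def)

text \<open>The module laws speak of the operations of \<open>real_ring\<close>; unfolding that
  record turns them into laws with ordinary real arithmetic. The next lemmas are obtained in the
  same way.\<close>

lemma superalgebra_smult_closed:
  assumes "superalgebra A" "x \<in> carrier A"
  shows "c \<odot>\<^bsub>A\<^esub> x \<in> carrier A"
  using module.smult_closed[OF superalgebra_module[OF assms(1)], of c x] assms(2)
  by (simp add: real_ring_def)

lemma superalgebra_smult_one:
  assumes "superalgebra A" "x \<in> carrier A"
  shows "1 \<odot>\<^bsub>A\<^esub> x = x"
  using module.smult_one[OF superalgebra_module[OF assms(1)] assms(2)]
  by (simp add: real_ring_def)

lemma superalgebra_smult_assoc:
  assumes "superalgebra A" "x \<in> carrier A"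
  shows "(c * d) \<odot>\<^bsub>A\<^esub> x = c \<odot>\<^bsub>A\<^esub> (d \<odot>\<^bsub>A\<^esub> x)"
  using module.smult_assoc1[OF superalgebra_module[OF assms(1)], of c d x] assms(2)
  by (simp add: real_ring_def)

lemma superalgebra_smult_l_distr:
  assumes "superalgebra A" "x \<in> carrier A"
  shows "(c + d) \<odot>\<^bsub>A\<^esub> x = c \<odot>\<^bsub>A\<^esub> x \<oplus>\<^bsub>A\<^esub> d \<odot>\<^bsub>A\<^esub> x"
  using module.smult_l_distr[OF superalgebra_module[OF assms(1)], of c d x] assms(2)
  by (simp add: real_ring_def)

lemma superalgebra_smult_r_distr:
  assumes "superalgebra A" "x \<in> carrier A" "y \<in> carrier A"
  shows "c \<odot>\<^bsub>A\<^esub> (x \<oplus>\<^bsub>A\<^esub> y) = c \<odot>\<^bsub>A\<^esub> x \<oplus>\<^bsub>A\<^esub> c \<odot>\<^bsub>A\<^esub> y"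
  using module.smult_r_distr[OF superalgebra_module[OF assms(1)], of c x y] assms(2,3)
  by (simp add: real_ring_def)

lemma superalgebra_smult_zero:
  assumes "superalgebra A"
  shows "c \<odot>\<^bsub>A\<^esub> \<zero>\<^bsub>A\<^esub> = \<zero>\<^bsub>A\<^esub>"
  using module.smult_r_null[OF superalgebra_module[OF assms(1)], of c]
  by (simp add: real_ring_def)

lemma superalgebra_smult_null:
  assumes "superalgebra A" "x \<in> carrier A"
  shows "0 \<odot>\<^bsub>A\<^esub> x = \<zero>\<^bsub>A\<^esub>"
  using module.smult_l_null[OF superalgebra_module[OF assms(1)] assms(2)]
  by (simp add: real_ring_def)

text \<open>Translates the scalar sign produced by \<open>psign\<close> into ring negation, so that
  signed identities become identities in a ring.\<close>

lemma superalgebra_smult_minus_one: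
  assumes "superalgebra A" "x \<in> carrier A"
  shows "(-1) \<odot>\<^bsub>A\<^esub> x = \<ominus>\<^bsub>A\<^esub> x"
proof -
  interpret ring A using assms superalgebra_ring by blast
  have "(-1) \<odot>\<^bsub>A\<^esub> x \<oplus>\<^bsub>A\<^esub> x = \<zero>\<^bsub>A\<^esub>"
    using superalgebra_smult_l_distr[OF assms, of "-1" 1]
      superalgebra_smult_one[OF assms] superalgebra_smult_null[OF assms] by simp
  then show ?thesis
    using minus_equality assms superalgebra_smult_closed by metis
qed

lemma superalgebra_smult_minus:
  assumes "superalgebra A" "x \<in> carrier A"
  shows "c \<odot>\<^bsub>A\<^esub> (\<ominus>\<^bsub>A\<^esub> x) = \<ominus>\<^bsub>A\<^esub> (c \<odot>\<^bsub>A\<^esub> x)"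
  using superalgebra_smult_assoc[OF assms, of c "-1"] superalgebra_smult_assoc[OF assms, of "-1" c]
    superalgebra_smult_minus_one[OF assms(1)] superalgebra_smult_closed[OF assms] assms(2)
  by simp

lemma superalgebra_smult_eq_zeroD:
  assumes "superalgebra A" "x \<in> carrier A" "c \<odot>\<^bsub>A\<^esub> x = \<zero>\<^bsub>A\<^esub>" "c \<noteq> 0"
  shows "x = \<zero>\<^bsub>A\<^esub>"
  using superalgebra_smult_assoc[OF assms(1,2), of "inverse c" c] assms
  by (simp add: superalgebra_smult_one superalgebra_smult_zero)

text \<open>Real scalars leave no 2-torsion: \<open>x \<oplus> x\<close> is the multiple of
  \<open>x\<close> by 2. This later removes the factor in [Q,Q] = 2P.\<close>

lemma superalgebra_double_eq_zeroD:
  assumes "superalgebra A" "x \<in> carrier A" "x \<oplus>\<^bsub>A\<^esub> x = \<zero>\<^bsub>A\<^esub>"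
  shows "x = \<zero>\<^bsub>A\<^esub>"
  using superalgebra_smult_l_distr[OF assms(1,2), of 1 1] superalgebra_smult_eq_zeroD[OF assms(1,2), of 2]
    assms by (simp add: superalgebra_smult_one)

lemma superalgebra_homog_carrier: "superalgebra A \<Longrightarrow> x \<in> homog A p \<Longrightarrow> x \<in> carrier A"
  and superalgebra_homog_zero: "superalgebra A \<Longrightarrow> \<zero>\<^bsub>A\<^esub> \<in> homog A p"
  and superalgebra_homog_add:
    "superalgebra A \<Longrightarrow> x \<in> homog A p \<Longrightarrow> y \<in> homog A p \<Longrightarrow> x \<oplus>\<^bsub>A\<^esub> y \<in> homog A p"
  and superalgebra_homog_smult: "superalgebra A \<Longrightarrow> x \<in> homog A p \<Longrightarrow> c \<odot>\<^bsub>A\<^esub> x \<in> homog A p"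
  by (auto simp: superalgebra_def)

lemma superalgebra_homog_minus:
  assumes "superalgebra A" "x \<in> homog A p"
  shows "\<ominus>\<^bsub>A\<^esub> x \<in> homog A p"
  using superalgebra_homog_smult[OF assms, of "-1"] superalgebra_homog_carrier[OF assms]
    superalgebra_smult_minus_one assms(1) by metis


section \<open>Restriction maps, graded derivations and their commutator\<close>

section \<open>Vector fields\<close>

lemma sheaf_superalgebra: "sheaf M \<Longrightarrow> openin (body M) U \<Longrightarrow> superalgebra (sect M U)"
  by (simp add: sheaf_def)

lemma sheaf_restr_hom:
  "sheaf M \<Longrightarrow> openin (body M) U \<Longrightarrow> openin (body M) V \<Longrightarrow> V \<subseteq> U \<Longrightarrow>
    restr M U V \<in> salg_hom (sect M U) (sect M V)"
  by (simp add: sheaf_def)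

lemma sheaf_restr:
  assumes "sheaf M" "openin (body M) U" "openin (body M) V" "V \<subseteq> U"
  shows "s \<in> carrier (sect M U) \<Longrightarrow> restr M U V s \<in> carrier (sect M V)"
    and "s \<in> carrier (sect M U) \<Longrightarrow> t \<in> carrier (sect M U) \<Longrightarrow>
      restr M U V (s \<oplus>\<^bsub>sect M U\<^esub> t) = restr M U V s \<oplus>\<^bsub>sect M V\<^esub> restr M U V t"
    and "s \<in> carrier (sect M U) \<Longrightarrow> restr M U V (c \<odot>\<^bsub>sect M U\<^esub> s) = c \<odot>\<^bsub>sect M V\<^esub> restr M U V s"
    and "restr M U V \<one>\<^bsub>sect M U\<^esub> = \<one>\<^bsub>sect M V\<^esub>"
    and "restr M U V \<zero>\<^bsub>sect M U\<^esub> = \<zero>\<^bsub>sect M V\<^esub>"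
    and "s \<in> carrier (sect M U) \<Longrightarrow> restr M U V (\<ominus>\<^bsub>sect M U\<^esub> s) = \<ominus>\<^bsub>sect M V\<^esub> restr M U V s"
proof -
  have h: "restr M U V \<in> salg_hom (sect M U) (sect M V)"
    using assms by (rule sheaf_restr_hom)
  then have hr: "restr M U V \<in> ring_hom (sect M U) (sect M V)"
    by (simp add: salg_hom_def)
  interpret ring_hom_ring "sect M U" "sect M V" "restr M U V"
    using ring_hom_ringI2[OF superalgebra_ring superalgebra_ring hr] sheaf_superalgebra assms(1-3) by blast
  show "s \<in> carrier (sect M U) \<Longrightarrow> restr M U V s \<in> carrier (sect M V)"
    and "s \<in> carrier (sect M U) \<Longrightarrow> t \<in> carrier (sect M U) \<Longrightarrow>
      restr M U V (s \<oplus>\<^bsub>sect M U\<^esub> t) = restr M U V s \<oplus>\<^bsub>sect M V\<^esub> restr M U V t"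
    and "restr M U V \<one>\<^bsub>sect M U\<^esub> = \<one>\<^bsub>sect M V\<^esub>"
    and "restr M U V \<zero>\<^bsub>sect M U\<^esub> = \<zero>\<^bsub>sect M V\<^esub>"
    and "s \<in> carrier (sect M U) \<Longrightarrow> restr M U V (\<ominus>\<^bsub>sect M U\<^esub> s) = \<ominus>\<^bsub>sect M V\<^esub> restr M U V s"
    by simp_all
  show "s \<in> carrier (sect M U) \<Longrightarrow> restr M U V (c \<odot>\<^bsub>sect M U\<^esub> s) = c \<odot>\<^bsub>sect M V\<^esub> restr M U V s"
    using h by (simp add: salg_hom_def)
qed

lemma vf_homogD:
  assumes "X \<in> vf_homog M p" "openin (body M) U"
  shows "s \<in> carrier (sect M U) \<Longrightarrow> X U s \<in> carrier (sect M U)"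
    and "s \<in> carrier (sect M U) \<Longrightarrow> t \<in> carrier (sect M U) \<Longrightarrow>
      X U (s \<oplus>\<^bsub>sect M U\<^esub> t) = X U s \<oplus>\<^bsub>sect M U\<^esub> X U t"
    and "s \<in> carrier (sect M U) \<Longrightarrow> X U (c \<odot>\<^bsub>sect M U\<^esub> s) = c \<odot>\<^bsub>sect M U\<^esub> X U s"
    and "s \<in> homog (sect M U) q \<Longrightarrow> X U s \<in> homog (sect M U) (p + q)"
    and "s \<in> homog (sect M U) q \<Longrightarrow> t \<in> carrier (sect M U) \<Longrightarrow>
      X U (s \<otimes>\<^bsub>sect M U\<^esub> t) = X U s \<otimes>\<^bsub>sect M U\<^esub> t
        \<oplus>\<^bsub>sect M U\<^esub> psign (p * q) \<odot>\<^bsub>sect M U\<^esub> (s \<otimes>\<^bsub>sect M U\<^esub> X U t)"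
    and "openin (body M) V \<Longrightarrow> V \<subseteq> U \<Longrightarrow> s \<in> carrier (sect M U) \<Longrightarrow>
      X V (restr M U V s) = restr M U V (X U s)"
  using assms unfolding vf_homog_def by (auto simp: PiE_iff)

text \<open>Compatibility with scalars suffices: X(0) = X(0 * 0) = 0 * X(0).\<close>

lemma vf_homog_zero:
  assumes "sheaf M" "X \<in> vf_homog M p" "openin (body M) U"
  shows "X U \<zero>\<^bsub>sect M U\<^esub> = \<zero>\<^bsub>sect M U\<^esub>"
proof -
  have A: "superalgebra (sect M U)" using assms by (simp add: sheaf_superalgebra)
  interpret ring "sect M U" using A by (rule superalgebra_ring)
  show ?thesis
    using vf_homogD(3)[OF assms(2,3), of "\<zero>\<^bsub>sect M U\<^esub>" 0] vf_homogD(1)[OF assms(2,3), of "\<zero>\<^bsub>sect M U\<^esub>"]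
    by (simp add: superalgebra_smult_zero[OF A] superalgebra_smult_null[OF A])
qed

text \<open>Families are extensional both in the open set and in the section, so only values at
  genuine sections over open sets have to be compared.\<close>

lemma vf_eqI:
  assumes "X \<in> (\<Pi>\<^sub>E U\<in>opens M. carrier (sect M U) \<rightarrow>\<^sub>E carrier (sect M U))"
    and "Y \<in> (\<Pi>\<^sub>E U\<in>opens M. carrier (sect M U) \<rightarrow>\<^sub>E carrier (sect M U))"
    and "\<And>U s. openin (body M) U \<Longrightarrow> s \<in> carrier (sect M U) \<Longrightarrow> X U s = Y U s"
  shows "X = Y"
proof (rule PiE_ext[OF assms(1,2)])
  fix U assume U: "U \<in> opens M"
  have "X U \<in> carrier (sect M U) \<rightarrow>\<^sub>E carrier (sect M U)"
    "Y U \<in> carrier (sect M U) \<rightarrow>\<^sub>E carrier (sect M U)"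
    using PiE_mem[OF assms(1) U] PiE_mem[OF assms(2) U] by simp_all
  then show "X U = Y U"
    by (rule PiE_ext) (use U assms(3) in simp)
qed

lemma vf_homog_PiE:
  "X \<in> vf_homog M p \<Longrightarrow> X \<in> (\<Pi>\<^sub>E U\<in>opens M. carrier (sect M U) \<rightarrow>\<^sub>E carrier (sect M U))"
  by (simp add: vf_homog_def)

text \<open>The parity is arbitrary because the zero field serves as the missing component when a
  homogeneous field is viewed as an element of \<open>Vect M\<close>.\<close>

lemma vf_zero_homog:
  assumes "sheaf M"
  shows "vf_zero M \<in> vf_homog M p"
proof -
  have *: "ring (sect M U)" "superalgebra (sect M U)" if "openin (body M) U" for U
    using assms that superalgebra_ring sheaf_superalgebra by blast+
  have hc: "x \<in> carrier (sect M U)" if "openin (body M) U" "x \<in> homog (sect M U) q" for x U q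
    using superalgebra_homog_carrier[OF *(2)[OF that(1)] that(2)] .
  have "vf_zero M \<in> (\<Pi>\<^sub>E U\<in>opens M. carrier (sect M U) \<rightarrow>\<^sub>E carrier (sect M U))"
    using ring.ring_simprules(2)[OF *(1)] by (auto simp: vf_zero_def PiE_iff)
  moreover have "vf_zero M U s = \<zero>\<^bsub>sect M U\<^esub>"
    if "openin (body M) U" "s \<in> carrier (sect M U)" for U s
    using that by (simp add: vf_zero_def)
  ultimately show ?thesis
    \<comment> \<open>The subgoals follow the clauses of \<open>vf_homog\<close>: function space,
      additivity, scalars, parity, Leibniz rule, restriction.\<close>
    unfolding vf_homog_def
    apply (intro CollectI conjI ballI allI impI)
    subgoal by simp
    subgoal using * by (simp add: ring.ring_simprules(1,2,8))
    subgoal using * by (simp add: superalgebra_smult_closed superalgebra_smult_zero)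
    subgoal using * by (simp add: hc superalgebra_homog_zero)
    subgoal for U q s t using * hc[of U s q]
      by (simp add: superalgebra_smult_zero ring.ring_simprules(2,5,8) ring.ring_simprules(24,25))
    subgoal using assms by (simp add: sheaf_restr)
    done
qed

lemma vf_homog_add_zero:
  assumes "sheaf M" "X \<in> vf_homog M p"
  shows "vf_add M X (vf_zero M) = X" "vf_add M (vf_zero M) X = X"
proof -
  have *: "ring (sect M U)" if "openin (body M) U" for U
    using assms that superalgebra_ring sheaf_superalgebra by blast
  note XP = vf_homog_PiE[OF assms(2)]
  show "vf_add M X (vf_zero M) = X" "vf_add M (vf_zero M) X = X"
    by (rule vf_eqI[OF _ XP];
      auto simp: vf_add_def vf_zero_def vf_homogD(1)[OF assms(2)] ring.ring_simprules[OF *])+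
qed

lemma vf_homog_subset_Vect:
  assumes "sheaf M"
  shows "vf_homog M p \<subseteq> Vect M"
proof
  fix X assume X: "X \<in> vf_homog M p"
  show "X \<in> Vect M"
  proof (cases "p = 0")
    case True
    then show ?thesis
      using X vf_homog_add_zero(1)[OF assms X] vf_zero_homog[OF assms] unfolding Vect_def by force
  next
    case False
    then show ?thesis
      using X vf_homog_add_zero(2)[OF assms X] vf_zero_homog[OF assms] unfolding Vect_def by force
  qed
qed

text \<open>\<open>parity\<close> may differ from \<open>p\<close> when a field has both parities;
  it then takes the value 1, which is still a correct parity of the field.\<close>

lemma vf_homog_parity: "X \<in> vf_homog M p \<Longrightarrow> X \<in> vf_homog M (parity M X)"
  by (cases p) (auto simp: parity_def)

text \<open>The sign computation behind the Leibniz rule for [X,Y] applied to a product of sections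
  S and T. Here \<open>a\<close>, \<open>b\<close>, \<open>r\<close> are the parities of X, Y, S;
  \<open>x\<close>, \<open>k\<close> stand for XYS, YXS; \<open>w\<close>, \<open>l\<close> for XYT,
  YXT; \<open>y\<close>, \<open>u\<close> for XS, YS; \<open>v\<close>, \<open>z\<close> for XT, YT;
  and \<open>s\<close>, \<open>t\<close> for S, T. The mixed products \<open>u \<otimes> v\<close>
  and \<open>y \<otimes> z\<close> cancel in each of the eight parity cases. Scalar multiplication
  enters as a map \<open>sc\<close> known only at 1 and -1, which leaves a pure ring
  identity.\<close>

lemma (in ring) graded_commutator_leibniz:
  assumes "x \<in> carrier R" "y \<in> carrier R" "z \<in> carrier R" "u \<in> carrier R" "v \<in> carrier R"
    "w \<in> carrier R" "k \<in> carrier R" "l \<in> carrier R" "s \<in> carrier R" "t \<in> carrier R"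
    and "\<And>x. x \<in> carrier R \<Longrightarrow> sc 1 x = x" "\<And>x. x \<in> carrier R \<Longrightarrow> sc (-1) x = \<ominus> x"
  shows "(x \<otimes> t \<oplus> sc (psign (a * (b + r))) (u \<otimes> v)
      \<oplus> sc (psign (b * r)) (y \<otimes> z \<oplus> sc (psign (a * r)) (s \<otimes> w)))
    \<ominus> sc (psign (a * b)) (k \<otimes> t \<oplus> sc (psign (b * (a + r))) (y \<otimes> z)
      \<oplus> sc (psign (a * r)) (u \<otimes> v \<oplus> sc (psign (b * r)) (s \<otimes> l)))
    = (x \<ominus> sc (psign (a * b)) k) \<otimes> t
      \<oplus> sc (psign ((a + b) * r)) (s \<otimes> (w \<ominus> sc (psign (a * b)) l))"
  using assms by (cases a; cases b; cases r; simp add: psign_def; algebra)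

text \<open>Needed for the term <[Q,Y]|Q> of the Lie derivative: graded symmetry moves Q to the
  first slot only against a homogeneous field. The parity is expressed through \<open>parity\<close>
  because the sign in \<open>bracket\<close> is.\<close>

lemma vf_homog_bracket:
  assumes "sheaf M" "X \<in> vf_homog M p" "Y \<in> vf_homog M q"
  shows "bracket M X Y \<in> vf_homog M (parity M X + parity M Y)"
proof -
  define a b where "a = parity M X" and "b = parity M Y"
  have X: "X \<in> vf_homog M a" and Y: "Y \<in> vf_homog M b"
    using assms(2,3) vf_homog_parity by (auto simp: a_def b_def)
  have A: "superalgebra (sect M U)" if "openin (body M) U" for U
    using assms that sheaf_superalgebra by blast
  have R: "ring (sect M U)" if "openin (body M) U" for U
    using A that superalgebra_ring by blast
  note XD = vf_homogD[OF X] and YD = vf_homogD[OF Y]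
  have br: "bracket M X Y U s = X U (Y U s) \<ominus>\<^bsub>sect M U\<^esub> (psign (a * b) \<odot>\<^bsub>sect M U\<^esub> Y U (X U s))"
    if "openin (body M) U" "s \<in> carrier (sect M U)" for U s
    using that by (simp add: bracket_def a_def b_def)
  have closed: "bracket M X Y U s \<in> carrier (sect M U)"
    if "openin (body M) U" "s \<in> carrier (sect M U)" for U s
    using that by (simp add: br XD YD A superalgebra_smult_closed ring.ring_simprules[OF R])
  have add: "bracket M X Y U (s \<oplus>\<^bsub>sect M U\<^esub> t) = bracket M X Y U s \<oplus>\<^bsub>sect M U\<^esub> bracket M X Y U t"
    if U: "openin (body M) U" and s: "s \<in> carrier (sect M U)" and t: "t \<in> carrier (sect M U)" for U s t
  proof -
    interpret ring "sect M U" using R U by blast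
    show ?thesis
      using s t U
      by (simp add: br XD YD superalgebra_smult_r_distr[OF A] superalgebra_smult_closed[OF A])
        (simp add: XD YD superalgebra_smult_closed[OF A] a_minus_def minus_add a_ac)
  qed
  have smult: "bracket M X Y U (c \<odot>\<^bsub>sect M U\<^esub> s) = c \<odot>\<^bsub>sect M U\<^esub> bracket M X Y U s"
    if U: "openin (body M) U" and s: "s \<in> carrier (sect M U)" for U s c
  proof -
    interpret ring "sect M U" using R U by blast
    show ?thesis
      using s U
      by (simp add: br XD YD superalgebra_smult_closed[OF A] a_minus_def superalgebra_smult_r_distr[OF A]
          superalgebra_smult_minus[OF A] superalgebra_smult_assoc[OF A, symmetric] mult.commute)
  qed
  have homog: "bracket M X Y U s \<in> homog (sect M U) (a + b + r)"
    if U: "openin (body M) U" and s: "s \<in> homog (sect M U) r" for U s r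
  proof -
    have sc: "s \<in> carrier (sect M U)" using superalgebra_homog_carrier[OF A[OF U] s] .
    have "X U (Y U s) \<in> homog (sect M U) (a + b + r)"
      using XD(4)[OF U YD(4)[OF U s]] by (simp only: ac_simps)
    moreover have "Y U (X U s) \<in> homog (sect M U) (a + b + r)"
      using YD(4)[OF U XD(4)[OF U s]] by (simp only: ac_simps)
    ultimately show ?thesis
      using A[OF U] unfolding br[OF U sc] a_minus_def
      by (simp add: superalgebra_homog_add superalgebra_homog_minus superalgebra_homog_smult)
  qed
  have leibniz: "bracket M X Y U (s \<otimes>\<^bsub>sect M U\<^esub> t) = bracket M X Y U s \<otimes>\<^bsub>sect M U\<^esub> t
      \<oplus>\<^bsub>sect M U\<^esub> psign ((a + b) * r) \<odot>\<^bsub>sect M U\<^esub> (s \<otimes>\<^bsub>sect M U\<^esub> bracket M X Y U t)"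
    if U: "openin (body M) U" and s: "s \<in> homog (sect M U) r" and t: "t \<in> carrier (sect M U)" for U s r t
  proof -
    interpret ring "sect M U" using R U by blast
    have sc: "s \<in> carrier (sect M U)" using superalgebra_homog_carrier[OF A[OF U] s] .
    note cl = sc t XD(1)[OF U] YD(1)[OF U]
    \<comment> \<open>Two applications of the Leibniz rule; the section \<open>Y U s\<close> has
      parity \<open>b + r\<close>, which accounts for the sign
      \<open>psign (a * (b + r))\<close>.\<close>
    have XY: "X U (Y U (s \<otimes>\<^bsub>sect M U\<^esub> t)) =
        X U (Y U s) \<otimes>\<^bsub>sect M U\<^esub> t
        \<oplus>\<^bsub>sect M U\<^esub> psign (a * (b + r)) \<odot>\<^bsub>sect M U\<^esub> (Y U s \<otimes>\<^bsub>sect M U\<^esub> X U t)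
        \<oplus>\<^bsub>sect M U\<^esub> psign (b * r) \<odot>\<^bsub>sect M U\<^esub> (X U s \<otimes>\<^bsub>sect M U\<^esub> Y U t
          \<oplus>\<^bsub>sect M U\<^esub> psign (a * r) \<odot>\<^bsub>sect M U\<^esub> (s \<otimes>\<^bsub>sect M U\<^esub> X U (Y U t)))"
      by (simp add: YD(5)[OF U s t] XD(2,3)[OF U] cl superalgebra_smult_closed[OF A[OF U]]
          XD(5)[OF U YD(4)[OF U s]] XD(5)[OF U s])
    have YX: "Y U (X U (s \<otimes>\<^bsub>sect M U\<^esub> t)) =
        Y U (X U s) \<otimes>\<^bsub>sect M U\<^esub> t
        \<oplus>\<^bsub>sect M U\<^esub> psign (b * (a + r)) \<odot>\<^bsub>sect M U\<^esub> (X U s \<otimes>\<^bsub>sect M U\<^esub> Y U t)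
        \<oplus>\<^bsub>sect M U\<^esub> psign (a * r) \<odot>\<^bsub>sect M U\<^esub> (Y U s \<otimes>\<^bsub>sect M U\<^esub> X U t
          \<oplus>\<^bsub>sect M U\<^esub> psign (b * r) \<odot>\<^bsub>sect M U\<^esub> (s \<otimes>\<^bsub>sect M U\<^esub> Y U (X U t)))"
      by (simp add: XD(5)[OF U s t] YD(2,3)[OF U] cl superalgebra_smult_closed[OF A[OF U]]
          YD(5)[OF U XD(4)[OF U s]] YD(5)[OF U s])
    show ?thesis
      unfolding br[OF U m_closed[OF sc t]] br[OF U sc] br[OF U t] XY YX
      by (rule graded_commutator_leibniz)
        (simp_all add: cl superalgebra_smult_one[OF A[OF U]] superalgebra_smult_minus_one[OF A[OF U]])
  qed
  have restr: "bracket M X Y V (restr M U V s) = restr M U V (bracket M X Y U s)"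
    if U: "openin (body M) U" and V: "openin (body M) V" and VU: "V \<subseteq> U"
      and s: "s \<in> carrier (sect M U)" for U V s
    using s XD(1)[OF U] YD(1)[OF U]
    by (simp add: br[OF U] br[OF V] a_minus_def sheaf_restr[OF assms(1) U V VU] XD(6)[OF U V VU]
        YD(6)[OF U V VU] superalgebra_smult_closed[OF A[OF U]] ring.ring_simprules(3)[OF R[OF U]])
  have "bracket M X Y \<in> (\<Pi>\<^sub>E U\<in>opens M. carrier (sect M U) \<rightarrow>\<^sub>E carrier (sect M U))"
    using closed by (auto simp: bracket_def PiE_iff)
  then show ?thesis
    unfolding vf_homog_def a_def[symmetric] b_def[symmetric]
    using add smult homog leibniz restr by simp
qed

section \<open>Multiples of a vector field, and sections over the empty set\<close>

lemma vf_scale_PiE: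
  assumes "sheaf M" "X \<in> vf_homog M p" "f \<in> carrier (smooth_functions M)"
  shows "vf_scale M f X \<in> (\<Pi>\<^sub>E U\<in>opens M. carrier (sect M U) \<rightarrow>\<^sub>E carrier (sect M U))"
proof -
  have "restr M (points M) U f \<otimes>\<^bsub>sect M U\<^esub> X U s \<in> carrier (sect M U)"
    if "openin (body M) U" "s \<in> carrier (sect M U)" for U s
  proof -
    have R: "ring (sect M U)"
      using superalgebra_ring[OF sheaf_superalgebra[OF assms(1) that(1)]] .
    have "U \<subseteq> points M" using that(1) by (rule openin_subset)
    then show ?thesis
      using ring.ring_simprules(5)[OF R] vf_homogD(1)[OF assms(2) that] that
        sheaf_restr(1)[OF assms(1) openin_topspace that(1) _ assms(3)] by simp
  qed
  then show ?thesis by (simp add: vf_scale_def PiE_iff)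
qed

text \<open>Used to see that Q belongs to its own span.\<close>

lemma vf_scale_one:
  assumes "sheaf M" "X \<in> vf_homog M p"
  shows "vf_scale M \<one>\<^bsub>smooth_functions M\<^esub> X = X"
proof -
  have R: "ring (sect M U)" if "openin (body M) U" for U
    using superalgebra_ring[OF sheaf_superalgebra[OF assms(1) that]] .
  show ?thesis
  proof (rule vf_eqI)
    show "vf_scale M \<one>\<^bsub>smooth_functions M\<^esub> X \<in> (\<Pi>\<^sub>E U\<in>opens M. carrier (sect M U) \<rightarrow>\<^sub>E carrier (sect M U))"
      by (rule vf_scale_PiE[OF assms]) (simp add: ring.ring_simprules(6)[OF R])
    show "X \<in> (\<Pi>\<^sub>E U\<in>opens M. carrier (sect M U) \<rightarrow>\<^sub>E carrier (sect M U))"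
      by (rule vf_homog_PiE[OF assms(2)])
    fix U s assume U: "openin (body M) U" and s: "s \<in> carrier (sect M U)"
    then show "vf_scale M \<one>\<^bsub>smooth_functions M\<^esub> X U s = X U s"
      using sheaf_restr(4)[OF assms(1) openin_topspace U openin_subset[OF U]]
        ring.ring_simprules(12)[OF R[OF U]] vf_homogD(1)[OF assms(2) U s]
      by (simp add: vf_scale_def)
  qed
qed

text \<open>The empty set is covered by the empty family, for which the gluing condition is vacuous;
  uniqueness of the glued section then identifies all sections.\<close>

lemma sheaf_empty_section:
  assumes "sheaf M" "s \<in> carrier (sect M {})" "t \<in> carrier (sect M {})"
  shows "s = t"
proof -
  have "\<exists>!t. t \<in> carrier (sect M (\<Union>{})) \<and> (\<forall>U\<in>{}. restr M (\<Union>{}) U t = (\<lambda>_. undefined) U)"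
    using assms(1) unfolding sheaf_def
    by (elim conjE) (erule allE[of _ "{}"], simp)
  then show ?thesis using assms(2,3) by auto
qed


section \<open>Smooth coefficients and coordinate sections of the model\<close>

section \<open>Smooth functions and model vector fields\<close>

text \<open>On an open set derivatives depend only on the values inside the set. This matters
  because model sections are extended by zero, so they agree with the usual formulas on
  \<open>U\<close> only. Both functions vary in the induction, since the hypothesis is applied to
  their partial derivatives.\<close>

lemma C_on_cong:
  assumes "open U" "\<And>x. x \<in> U \<Longrightarrow> f x = g x" "C_on k U f"
  shows "C_on k U g"
  using assms(2,3)
proof (induction k arbitrary: f g)
  case 0
  then show ?case by (simp cong: continuous_on_cong)
next
  case (Suc k)
  have "frechet_derivative f (at x) = frechet_derivative g (at x)" if "x \<in> U" for x
  proof (rule frechet_derivative_transform_within_open[OF _ assms(1) that Suc.prems(1)])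
    show "f differentiable at x"
      using Suc.prems(2) that assms(1) by (simp add: differentiable_on_eq_differentiable_at)
  qed
  then have "C_on k U (\<lambda>x. frechet_derivative g (at x) (axis i 1))" for i
    using Suc.prems(2) by - (rule Suc.IH[of "\<lambda>x. frechet_derivative f (at x) (axis i 1)"
          "\<lambda>x. frechet_derivative g (at x) (axis i 1)"], auto)
  moreover have "g differentiable_on U"
    using Suc.prems differentiable_transform_within[of f _ U 1 g]
    by (simp add: differentiable_on_def)
  ultimately show ?case by simp
qed

lemma C_on_const: "C_on k U (\<lambda>_. c)"
  by (induction k arbitrary: c) simp_all

lemma frechet_derivative_vec_nth: "frechet_derivative (\<lambda>y. y $ i) (at x) = (\<lambda>h. h $ i)"
  by (rule frechet_derivative_at[symmetric]) (rule bounded_linear_imp_has_derivative[OF bounded_linear_vec_nth])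

lemma C_on_vec_nth: "C_on k U (\<lambda>x. x $ i)"
proof (cases k)
  case 0
  then show ?thesis by (auto intro: continuous_intros)
next
  case (Suc j)
  have "(\<lambda>x. x $ i) differentiable_on U"
    by (simp add: differentiable_on_def bounded_linear_imp_differentiable bounded_linear_vec_nth)
  then show ?thesis
    by (simp add: Suc frechet_derivative_vec_nth C_on_const)
qed

lemma smooth_on_cong:
  "open U \<Longrightarrow> (\<And>x. x \<in> U \<Longrightarrow> f x = g x) \<Longrightarrow> smooth_on U f \<Longrightarrow> smooth_on U g"
  unfolding smooth_on_def using C_on_cong[of U f g] by simp

lemma smooth_on_const: "smooth_on U (\<lambda>_. c)"
  and smooth_on_vec_nth: "smooth_on U (\<lambda>x. x $ i)"
  by (simp_all add: smooth_on_def C_on_const C_on_vec_nth)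

text \<open>Sections over \<open>V\<close> must vanish outside \<open>V\<close>, so the odd
  coordinate \<open>theta\<close> has to be cut off there.\<close>

definition theta_on :: "(real ^ 'n) set \<Rightarrow> nat \<Rightarrow> 'n model_section"
  where "theta_on V j = (\<lambda>x I. if x \<in> V \<and> I = {j} then 1 else 0)"

text \<open>The even coordinate as a section over \<open>V\<close>: its only coefficient sits at the
  empty monomial, and it is cut off outside \<open>V\<close>.\<close>

definition coord_on :: "(real ^ 'n) set \<Rightarrow> 'n \<Rightarrow> 'n model_section"
  where "coord_on V k = (\<lambda>x I. if x \<in> V \<and> I = {} then x $ k else 0)"

lemma theta_on_carrier:
  assumes "open V" "j < q"
  shows "theta_on V j \<in> carrier (sect (model q) V)"
proof -
  have "smooth_on V (\<lambda>x. theta_on V j x I)" for I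
    by (rule smooth_on_cong[OF assms(1) _ smooth_on_const[of V "if I = {j} then 1 else 0"]])
      (simp add: theta_on_def)
  then show ?thesis
    using assms(2) by (auto simp: model_def model_salg_def theta_on_def)
qed

lemma coord_on_carrier:
  assumes "open V"
  shows "coord_on V k \<in> carrier (sect (model q) V)"
proof -
  have "smooth_on V (\<lambda>x. coord_on V k x I)" for I
  proof (cases "I = {}")
    case True
    show ?thesis
      by (rule smooth_on_cong[OF assms _ smooth_on_vec_nth[of V k]]) (simp add: coord_on_def True)
  next
    case False
    then show ?thesis
      by (simp add: coord_on_def smooth_on_const)
  qed
  then show ?thesis
    by (auto simp: model_def model_salg_def coord_on_def)
qed

lemma partial_even_eq:
  assumes "open V" "f \<in> carrier (sect (model q) V)"
  shows "partial_even q k V f =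
    (\<lambda>x I. if x \<in> V then frechet_derivative (\<lambda>y. f y I) (at x) (axis k 1) else 0)"
  using assms by (simp add: partial_even_def model_def)

lemma partial_even_theta_on:
  assumes "open V" "j < q"
  shows "partial_even q k V (theta_on V j) = \<zero>\<^bsub>sect (model q) V\<^esub>"
proof -
  \<comment> \<open>Near a point of the open set \<open>V\<close> each coefficient of the odd
    coordinate is constant.\<close>
  have "frechet_derivative (\<lambda>y. theta_on V j y I) (at x) = frechet_derivative (\<lambda>y. if I = {j} then 1 else 0) (at x)"
    if "x \<in> V" for x I
    by (rule frechet_derivative_transform_within_open[OF _ assms(1) that, symmetric])
      (simp_all add: theta_on_def)
  then show ?thesis
    unfolding partial_even_eq[OF assms(1) theta_on_carrier[OF assms]]
    by (auto simp: model_def model_salg_def fun_eq_iff)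
qed

lemma partial_even_coord_on:
  assumes "open V"
  shows "partial_even q k V (coord_on V k) = \<one>\<^bsub>sect (model q) V\<^esub>"
proof -
  have "frechet_derivative (\<lambda>y. coord_on V k y I) (at x) (axis k 1) = (if I = {} then 1 else 0)"
    if "x \<in> V" for x I
  proof (cases "I = {}")
    case True
    \<comment> \<open>Differentiability is checked for the linear coordinate function; agreement on
      the open set \<open>V\<close> transfers its derivative to the cut-off section.\<close>
    have eq: "frechet_derivative (\<lambda>y. y $ k) (at x) = frechet_derivative (\<lambda>y. coord_on V k y I) (at x)"
      by (rule frechet_derivative_transform_within_open[OF _ assms that])
        (simp_all add: coord_on_def True bounded_linear_imp_differentiable bounded_linear_vec_nth)
    show ?thesis
      unfolding eq[symmetric] by (simp add: True frechet_derivative_vec_nth)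
  next
    case False
    then show ?thesis by (simp add: coord_on_def)
  qed
  then show ?thesis
    unfolding partial_even_eq[OF assms coord_on_carrier[OF assms]]
    by (auto simp: model_def model_salg_def fun_eq_iff)
qed

text \<open>This is Q \<tau> = 1: the odd derivative of \<tau> is 1, and the even derivative in
  \<tau> d/dt annihilates \<tau>.\<close>

lemma shander_field_theta_on:
  assumes "open V"
  shows "vf_add (model 1) (partial_odd 1 0) (vf_scale (model 1) (theta 0) (partial_even 1 k)) V
      (theta_on V 0) = \<one>\<^bsub>sect (model 1) V\<^esub>"
proof -
  have V: "openin (body (model 1)) V" using assms by (simp add: model_def)
  note c = theta_on_carrier[OF assms, of 0 1, simplified]
  have odd: "partial_odd 1 0 V (theta_on V 0) = \<one>\<^bsub>sect (model 1) V\<^esub>"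
  proof -
    \<comment> \<open>Only the empty monomial survives the odd derivative, and there the sign is +1,
      as no index precedes 0.\<close>
    have "0 \<notin> I \<Longrightarrow> insert 0 I = {0} \<longleftrightarrow> I = {}" for I :: "nat set" by auto
    then show ?thesis
      using V c by (auto simp: partial_odd_def theta_on_def fun_eq_iff model_def model_salg_def)
  qed
  have "vf_scale (model 1) (theta 0) (partial_even 1 k) V (theta_on V 0) = (\<lambda>x I. 0)"
    using V c partial_even_theta_on[OF assms, of 0 1 k]
    by (simp add: vf_scale_def) (simp add: model_def model_salg_def)
  then show ?thesis
    using V c odd by (simp add: vf_add_def) (simp add: model_def model_salg_def)
qed


section \<open>Comparison in Shander coordinates, existence of a point, and the Killing
  equation\<close>

section \<open>Super-null Riemannian manifolds\<close>

text \<open>The homeomorphism of a chart maps \<open>U\<close> onto \<open>V\<close>; hence pullback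
  of sections over all of \<open>V\<close> lands in the sections over \<open>U\<close>
  itself.\<close>

lemma chart_preimage_eq:
  assumes "chart M q U V \<phi> \<Phi>"
  shows "U \<inter> \<phi> -` V = U"
proof -
  have "openin (body M) U" and h: "homeomorphic_map (subtopology (body M) U) (top_of_set V) \<phi>"
    using assms by (auto simp: chart_def)
  then have "topspace (subtopology (body M) U) = U"
    using openin_subset by fastforce
  then have "\<phi> ` U = V"
    using homeomorphic_imp_surjective_map[OF h] by simp
  then show ?thesis by auto
qed

text \<open>Suppose P = fQ. Testing on \<tau> shows that f restricts to zero on \<open>U\<close>;
  testing on t then gives 1 = 0 over \<open>U\<close>. The point \<open>m\<close> is what makes this
  absurd, because its stalk is nonzero.\<close>

lemma shander_P_notin_span:
  fixes \<phi> :: "'p \<Rightarrow> real ^ 'n"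
  assumes M: "locally_superringed_space M"
    and sh: "shander_coordinates M Q P U V \<phi> \<Phi> k" and m: "m \<in> U"
    and Q: "Q \<in> vf_homog M p"
  shows "P \<notin> vf_span M Q"
proof
  assume "P \<in> vf_span M Q"
  then obtain f where f: "f \<in> carrier (smooth_functions M)" and P: "P = vf_scale M f Q"
    by (auto simp: vf_span_def)
  have sheaf: "sheaf M" using M by (simp add: locally_superringed_space_def)
  have ch: "chart M 1 U V \<phi> \<Phi>" using sh by (simp add: shander_coordinates_def)
  have U: "openin (body M) U" and V: "open V" using ch by (auto simp: chart_def)
  note UV = chart_preimage_eq[OF ch]
  have A: "superalgebra (sect M U)" using sheaf_superalgebra[OF sheaf U] .
  interpret ring "sect M U" using superalgebra_ring[OF A] .
  have "\<Phi> V \<in> salg_iso (sect (model 1) V) (sect M (U \<inter> \<phi> -` V))"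
    using ch V by (simp add: chart_def)
  then have hom: "\<Phi> V \<in> salg_hom (sect (model 1) V) (sect M U)"
    by (simp add: salg_iso_def UV)
  then have cl: "\<Phi> V s \<in> carrier (sect M U)" if "s \<in> carrier (sect (model 1) V)" for s
    using that by (auto simp: salg_hom_def ring_hom_def)
  have one: "\<Phi> V \<one>\<^bsub>sect (model 1) V\<^esub> = \<one>\<^bsub>sect M U\<^esub>"
    using hom by (auto simp: salg_hom_def ring_hom_def)
  define \<tau> t where "\<tau> = theta_on V 0" and "t = coord_on V k"
  have \<tau>: "\<tau> \<in> carrier (sect (model 1) V)" and t: "t \<in> carrier (sect (model 1) V)"
    using theta_on_carrier[OF V, of 0 1] coord_on_carrier[OF V, of k 1] by (simp_all add: \<tau>_def t_def)
  note Q\<tau> = shander_field_theta_on[OF V, of k, folded \<tau>_def]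
    and P\<tau> = partial_even_theta_on[OF V zero_less_one, of k, folded \<tau>_def]
    and Pt = partial_even_coord_on[OF V, of 1 k, folded t_def]
  \<comment> \<open>\<open>ring_hom\<close> records products, sums and one; that
    \<open>\<Phi> V\<close> preserves zero is derived from compatibility with scalars by writing
    zero as 0 times \<tau>.\<close>
  have "\<zero>\<^bsub>sect (model 1) V\<^esub> = 0 \<odot>\<^bsub>sect (model 1) V\<^esub> \<tau>"
    by (simp add: model_def model_salg_def)
  then have zero: "\<Phi> V \<zero>\<^bsub>sect (model 1) V\<^esub> = \<zero>\<^bsub>sect M U\<^esub>"
    using hom \<tau> cl[OF \<tau>] superalgebra_smult_null[OF A] by (simp add: salg_hom_def)
  have PU: "P U (\<Phi> V s) = \<Phi> V (partial_even 1 k V s)"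
    and QU: "Q U (\<Phi> V s) = \<Phi> V (vf_add (model 1) (partial_odd 1 0)
      (vf_scale (model 1) (theta 0) (partial_even 1 k)) V s)"
    if "s \<in> carrier (sect (model 1) V)" for s
    using sh V that UV unfolding shander_coordinates_def chart_expr_def by force+
  have Pf: "P U s = restr M (points M) U f \<otimes>\<^bsub>sect M U\<^esub> Q U s" if "s \<in> carrier (sect M U)" for s
    using that U by (simp add: P vf_scale_def)
  have fU: "restr M (points M) U f \<in> carrier (sect M U)"
    using sheaf_restr(1)[OF sheaf openin_topspace U openin_subset[OF U] f] .
  \<comment> \<open>Since Q \<tau> = 1, applying fQ to \<tau> recovers f on
    \<open>U\<close>.\<close>
  have "restr M (points M) U f = restr M (points M) U f \<otimes>\<^bsub>sect M U\<^esub> Q U (\<Phi> V \<tau>)"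
    using fU unfolding QU[OF \<tau>] Q\<tau> one by simp
  also have "\<dots> = P U (\<Phi> V \<tau>)"
    using Pf[OF cl[OF \<tau>]] by simp
  also have "\<dots> = \<zero>\<^bsub>sect M U\<^esub>"
    unfolding PU[OF \<tau>] P\<tau> zero ..
  finally have f0: "restr M (points M) U f = \<zero>\<^bsub>sect M U\<^esub>" .
  have "\<one>\<^bsub>sect M U\<^esub> = P U (\<Phi> V t)"
    unfolding PU[OF t] Pt one ..
  also have "\<dots> = \<zero>\<^bsub>sect M U\<^esub>"
    using Pf[OF cl[OF t]] vf_homogD(1)[OF Q U cl[OF t]] by (simp add: f0)
  finally have "\<one>\<^bsub>sect M U\<^esub> = \<zero>\<^bsub>sect M U\<^esub>" .
  moreover have "m \<in> points M" using m openin_subset[OF U] by blast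
  ultimately show False
    using M U m by (auto simp: locally_superringed_space_def local_stalk_def)
qed

text \<open>Without points the empty set is the only open set, and it carries a single section. All
  multiples of Q then equal the zero field, so the kernel is trivial, against degeneracy.\<close>

lemma super_null_points_nonempty:
  assumes M: "sheaf M" and Q: "Q \<in> vf_homog M p"
    and ker: "metric_ker M g = vf_span M Q" and deg: "degenerate M g"
  shows "points M \<noteq> {}"
proof
  assume e: "points M = {}"
  have opens: "U = {}" if "openin (body M) U" for U
    using openin_subset[OF that] e by simp
  have "vf_scale M f Q = vf_zero M" if f: "f \<in> carrier (smooth_functions M)" for f
  proof (rule vf_eqI)
    show S: "vf_scale M f Q \<in> (\<Pi>\<^sub>E U\<in>opens M. carrier (sect M U) \<rightarrow>\<^sub>E carrier (sect M U))"
      using vf_scale_PiE[OF M Q f] .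
    show Z: "vf_zero M \<in> (\<Pi>\<^sub>E U\<in>opens M. carrier (sect M U) \<rightarrow>\<^sub>E carrier (sect M U))"
      using vf_homog_PiE[OF vf_zero_homog[OF M]] .
    fix U s assume U: "openin (body M) U" and s: "s \<in> carrier (sect M U)"
    then have "vf_scale M f Q U s \<in> carrier (sect M U)" "vf_zero M U s \<in> carrier (sect M U)"
      using S Z by (auto simp: PiE_iff)
    then show "vf_scale M f Q U s = vf_zero M U s"
      using sheaf_empty_section[OF M] opens[OF U] by simp
  qed
  \<comment> \<open>Some coefficient must exist for the span to contain the zero field rather than
    be empty.\<close>
  moreover have "\<one>\<^bsub>smooth_functions M\<^esub> \<in> carrier (smooth_functions M)"
    using ring.ring_simprules(6)[OF superalgebra_ring[OF sheaf_superalgebra[OF M openin_topspace]]] .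
  ultimately have "vf_span M Q = {vf_zero M}"
    unfolding vf_span_def by force
  then show False using ker deg by (simp add: degenerate_def)
qed

lemma killing_imp_P_in_ker:
  assumes M: "sheaf M" and g: "metric M g" and Q: "Q \<in> vf_homog M 1" and P: "P \<in> vf_homog M 0"
    and QQ: "bracket M Q Q = vf_add M P P" and Qker: "Q \<in> metric_ker M g"
    and kill: "killing M g Q"
  shows "P \<in> metric_ker M g"
proof -
  let ?C = "smooth_functions M"
  have A: "superalgebra ?C" using sheaf_superalgebra[OF M openin_topspace] .
  interpret ring ?C using superalgebra_ring[OF A] .
  have Vect: "X \<in> Vect M" if "X \<in> vf_homog M p" for X p
    using vf_homog_subset_Vect[OF M] that by blast
  have g_closed: "g X Y \<in> carrier ?C" if "X \<in> Vect M" "Y \<in> Vect M" for X Y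
    using g that by (simp add: metric_def)
  have g_sym: "g X Y = psign (p * q) \<odot>\<^bsub>?C\<^esub> g Y X" if "X \<in> vf_homog M p" "Y \<in> vf_homog M q" for X Y p q
  proof -
    have "\<forall>p q. \<forall>X\<in>vf_homog M p. \<forall>Y\<in>vf_homog M q.
        g X Y \<in> homog ?C (p + q) \<and> g X Y = psign (p * q) \<odot>\<^bsub>?C\<^esub> g Y X"
      using g unfolding metric_def by (elim conjE)
    from this[rule_format, OF that] show ?thesis by (rule conjunct2)
  qed
  have g_add: "g X (vf_add M Y Z) = g X Y \<oplus>\<^bsub>?C\<^esub> g X Z" if "X \<in> Vect M" "Y \<in> Vect M" "Z \<in> Vect M" for X Y Z
    using g that by (simp add: metric_def)
  \<comment> \<open>\<open>metric_ker\<close> constrains the first slot; graded symmetry carries the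
    vanishing to the second slot, for homogeneous \<open>Y\<close>.\<close>
  have gQ: "g Y Q = \<zero>\<^bsub>?C\<^esub>" if "Y \<in> vf_homog M p" for Y p
  proof -
    have "g Q Y = \<zero>\<^bsub>?C\<^esub>" using Qker Vect[OF that] by (simp add: metric_ker_def)
    then show ?thesis using g_sym[OF that Q] superalgebra_smult_zero[OF A] by simp
  qed
  have gP: "g P Y = \<zero>\<^bsub>?C\<^esub>" if Y: "Y \<in> vf_homog M p" for Y p
  proof -
    note cl = g_closed[OF Vect[OF Y] Vect[OF P]]
    define e where "e = psign (parity M Q * parity M Y)"
    have e: "e \<noteq> 0" by (simp add: e_def psign_def)
    have "lie_derivative M g Q Y Q = \<zero>\<^bsub>?C\<^esub>"
      using kill Y Q unfolding killing_def by blast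
    \<comment> \<open>The first two terms are Q<Y|Q> and <[Q,Y]|Q>, both zero by \<open>gQ\<close>.
      In the third, [Q,Q] = P + P is inserted.\<close>
    moreover have "lie_derivative M g Q Y Q = \<ominus>\<^bsub>?C\<^esub> (e \<odot>\<^bsub>?C\<^esub> (g Y P \<oplus>\<^bsub>?C\<^esub> g Y P))"
      using vf_homog_zero[OF M Q openin_topspace] gQ[OF Y] gQ[OF vf_homog_bracket[OF M Q Y]]
        superalgebra_smult_closed[OF A, of "g Y P \<oplus>\<^bsub>?C\<^esub> g Y P" e] cl
      by (simp add: lie_derivative_def QQ g_add Vect[OF Y] Vect[OF P] e_def a_minus_def)
    ultimately have "e \<odot>\<^bsub>?C\<^esub> (g Y P \<oplus>\<^bsub>?C\<^esub> g Y P) = \<zero>\<^bsub>?C\<^esub>"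
      using superalgebra_smult_closed[OF A, of "g Y P \<oplus>\<^bsub>?C\<^esub> g Y P" e] cl
      by (metis a_closed minus_minus minus_zero)
    \<comment> \<open>First the nonzero sign \<open>e\<close> is cancelled, then the factor
      2.\<close>
    then have "g Y P = \<zero>\<^bsub>?C\<^esub>"
      using superalgebra_smult_eq_zeroD[OF A _ _ e] superalgebra_double_eq_zeroD[OF A cl] cl by simp
    then show ?thesis using g_sym[OF P Y] superalgebra_smult_zero[OF A] by simp
  qed
  \<comment> \<open>A general \<open>Y\<close> is split into its even and odd parts, and additivity
    in the second slot applies.\<close>
  have "g P Y = \<zero>\<^bsub>?C\<^esub>" if "Y \<in> Vect M" for Y
  proof -
    obtain Y0 Y1 where "Y = vf_add M Y0 Y1" "Y0 \<in> vf_homog M 0" "Y1 \<in> vf_homog M 1"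
      using \<open>Y \<in> Vect M\<close> by (auto simp: Vect_def)
    then show ?thesis using gP g_add[OF Vect[OF P]] Vect by simp
  qed
  then show ?thesis using Vect[OF P] by (simp add: metric_ker_def)
qed

theorem proposition2p4:
  fixes M :: "('p, 's) superspace"
    and g :: "('p, 's) pairing"
    and Q P :: "('p, 's) vfield"
  assumes "super_null_riemannian TYPE('n::finite) M g Q P"
  shows "\<not> killing M g Q"
proof
  assume kill: "killing M g Q"
  have L: "locally_superringed_space M"
    and g: "metric M g" and deg: "degenerate M g" and Q: "Q \<in> vf_homog M 1" and P: "P \<in> vf_homog M 0"
    and QQ: "bracket M Q Q = vf_add M P P" and ker: "metric_ker M g = vf_span M Q"
    and sh: "\<forall>m\<in>points M. \<exists>U V (\<phi> :: 'p \<Rightarrow> real ^ 'n) \<Phi> k. m \<in> U \<and> shander_coordinates M Q P U V \<phi> \<Phi> k"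
    using assms by (simp_all add: super_null_riemannian_def supermanifold_def)
  have M: "sheaf M" using L by (simp add: locally_superringed_space_def)
  \<comment> \<open>Q is the multiple of itself by 1, so it lies in the kernel; this is the premise
    that lets the Killing equation be evaluated against Q.\<close>
  have "Q \<in> vf_span M Q"
    using vf_scale_one[OF M Q]
      ring.ring_simprules(6)[OF superalgebra_ring[OF sheaf_superalgebra[OF M openin_topspace]]]
    unfolding vf_span_def by force
  then have "P \<in> vf_span M Q"
    using killing_imp_P_in_ker[OF M g Q P QQ _ kill] ker by simp
  \<comment> \<open>A point is required because Shander coordinates are only provided around
    points.\<close>
  moreover obtain m where "m \<in> points M"
    using super_null_points_nonempty[OF M Q ker deg] by blast
  then obtain U V k m and \<phi> :: "'p \<Rightarrow> real ^ 'n" and \<Phi>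
    where "m \<in> U" "shander_coordinates M Q P U V \<phi> \<Phi> k"
    using sh by blast
  ultimately show False using shander_P_notin_span[OF L _ _ Q] by blast
qed

end
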